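(* Let $\mathbf{k}$ be a field, $X=\{x_0,\dots,x_n\}$, and let $M$ be a non-empty proper subset of $\{0,\dots,n\}^2$. For every $(j,i)\in M$ let $h_{ji}\in\mathbf{k}\langle X\rangle$ be either $0$ or a homogeneous polynomial of degree $2$ with $\mathbf{LM}(h_{ji})<x_jx_i$. Let $$\mathcal{R}=\{f_{ji}=x_jx_i-h_{ji}\mid (j,i)\in M\}\subset\mathbf{k}\langle X\rangle,$$ let $I=(\mathcal{R})$ be the two-sided ideal generated by $\mathcal{R}$, and let $A=\mathbf{k}\langle X\rangle/I$, graded by length. The following conditions are equivalent. (1) The set $\mathcal{R}$ is a (quadratic) Gröbner basis of the ideal $I$. (2) $\dim A_3=|N(\mathcal{R})_3|$. (3) All ambiguities of overlap determined by $\mathbf{LM}(\mathcal{R})=\{x_jx_i\mid (j,i)\in M\}$ are $\mathcal{R}$-solvable. In this case $A$ is a PBW algebra.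
   Context: $\langle X\rangle$ is the free monoid on $X$, ordered by the degree-lexicographic order $<$ with $x_0<x_1<\dots<x_n$; $\mathbf{k}\langle X\rangle$ is the free associative unital algebra; $\mathbf{LM}(f)$ is the leading monomial of a nonzero $f$ with respect to $<$. A set $G\subseteq I$ of monic polynomials is a Gröbner basis of a two-sided ideal $I$ if $G$ generates $I$ and for every nonzero $f\in I$ there is $g\in G$ such that $\mathbf{LM}(g)$ is a (contiguous) subword of $\mathbf{LM}(f)$. $N(\mathcal{R})$ is the set of words containing no element of $\mathbf{LM}(\mathcal{R})$ as a subword (normal words modulo $\mathcal{R}$), and $N(\mathcal{R})_3$ is the set of those of length $3$. Reductions via $\mathcal{R}$: for words $u,v$ and $(j,i)\in M$, the $\mathbf{k}$-linear operator on $\mathbf{k}\langle X\rangle$ sending the word $u x_jx_i v$ to $u h_{ji} v$ and fixing all other words. An ambiguity of overlap is a word $\omega=x_kx_jx_i$ with $(k,j),(j,i)\in M$; it is $\mathcal{R}$-solvable if the composition of overlap $f_{kj}x_i-x_kf_{ji}=x_kh_{ji}-h_{kj}x_i$ can be reduced to $0$ by a finite sequence of reductions via $\mathcal{R}$. A quadratic algebra is a PBW algebra (in the sense of Priddy) if it has a presentation $\mathbf{k}\langle X\rangle/(\mathcal{R})$, for some enumeration of a finite set $X$ of degree-one generators, whose set $\mathcal{R}$ of quadratic relations is a Gröbner basis of $(\mathcal{R})$ with respect to the degree-lexicographic order. *)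

theory Defs
  imports
    "HOL-Algebra.Algebra"
    "HOL-Library.Poly_Mapping"
    "HOL-Library.List_Lenlexorder"
    "HOL-Library.Sublist"
begin

text \<open>
  The letter \<open>x\<^sub>i\<close> is the natural number \<open>i\<close> and a word is a list of letters.  The order on
  \<^typ>\<open>nat list\<close> provided by \<^theory>\<open>HOL-Library.List_Lenlexorder\<close> is the degree-lexicographic
  order (length first, then lexicographically from the left) with \<open>x\<^sub>0 < x\<^sub>1 < \<dots>\<close>.
\<close>

type_synonym word = "nat list"

text \<open>
  Concatenation as the monoid operation on words turns the finitely supported functions
  \<open>nat list \<Rightarrow>\<^sub>0 'k\<close>, with the convolution product of \<^theory>\<open>HOL-Library.Poly_Mapping\<close>, into the
  free associative unital algebra on countably many letters.
\<close>

instantiation list :: (type) monoid_add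
begin

definition zero_list_def: "(0 :: 'a list) = []"

definition plus_list_def: "(xs :: 'a list) + ys = xs @ ys"

instance
  by intro_classes (simp_all add: zero_list_def plus_list_def)

end

type_synonym 'k ncpoly = "word \<Rightarrow>\<^sub>0 'k"

abbreviation mon :: "word \<Rightarrow> 'k::field ncpoly"
  where "mon w \<equiv> Poly_Mapping.single w 1"

abbreviation const :: "'k \<Rightarrow> 'k::field ncpoly"
  where "const c \<equiv> Poly_Mapping.single [] c"

text \<open>The free monoid and the free algebra on \<open>{x\<^sub>0, \<dots>, x\<^sub>n}\<close>.\<close>

definition words :: "nat \<Rightarrow> word set"
  where "words n = lists {0..n}"

definition free_algebra :: "nat \<Rightarrow> 'k::field ncpoly ring"
  where "free_algebra n =
    \<lparr>carrier = {f. Poly_Mapping.keys f \<subseteq> words n}, monoid.mult = (*), one = 1, ring.zero = 0, ring.add = (+)\<rparr>"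

lemma ring_free_algebra: "ring (free_algebra n :: 'k::field ncpoly ring)"
proof (rule ringI)
  let ?F = "free_algebra n :: 'k ncpoly ring"
  show "abelian_group ?F"
  proof (rule abelian_groupI)
    fix x assume "x \<in> carrier ?F"
    then show "\<exists>y\<in>carrier ?F. y \<oplus>\<^bsub>?F\<^esub> x = \<zero>\<^bsub>?F\<^esub>"
      by (intro bexI[of _ "- x"]) (auto simp: free_algebra_def)
  qed (use Poly_Mapping.keys_add in \<open>fastforce simp: free_algebra_def algebra_simps\<close>)+
  show "Group.monoid ?F"
  proof
    fix x y assume *: "x \<in> carrier ?F" "y \<in> carrier ?F"
    have "Poly_Mapping.keys (x * y) \<subseteq> {a + b |a b. a \<in> Poly_Mapping.keys x \<and> b \<in> Poly_Mapping.keys y}"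
      by (rule keys_mult)
    also have "\<dots> \<subseteq> words n"
      using * by (fastforce simp: free_algebra_def words_def plus_list_def)
    finally show "x \<otimes>\<^bsub>?F\<^esub> y \<in> carrier ?F"
      by (simp add: free_algebra_def)
  qed (auto simp: free_algebra_def words_def zero_list_def algebra_simps)
qed (auto simp: free_algebra_def algebra_simps)

text \<open>The zero polynomial is homogeneous of every degree.\<close>

definition homogeneous :: "nat \<Rightarrow> 'k::field ncpoly \<Rightarrow> bool"
  where "homogeneous d f \<longleftrightarrow> (\<forall>w\<in>Poly_Mapping.keys f. length w = d)"

text \<open>The leading monomial; only meaningful for nonzero polynomials.\<close>

definition LM :: "'k::field ncpoly \<Rightarrow> word"
  where "LM f = Max (Poly_Mapping.keys f)"

definition monic :: "'k::field ncpoly \<Rightarrow> bool"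
  where "monic f \<longleftrightarrow> f \<noteq> 0 \<and> Poly_Mapping.lookup f (LM f) = 1"

definition groebner_basis :: "nat \<Rightarrow> 'k::field ncpoly set \<Rightarrow> 'k ncpoly set \<Rightarrow> bool"
  where "groebner_basis n G I \<longleftrightarrow>
    G \<subseteq> I \<and> (\<forall>g\<in>G. monic g) \<and> Idl\<^bsub>free_algebra n\<^esub> G = I \<and>
    (\<forall>f\<in>I. f \<noteq> 0 \<longrightarrow> (\<exists>g\<in>G. sublist (LM g) (LM f)))"

definition normal_words :: "nat \<Rightarrow> 'k::field ncpoly set \<Rightarrow> word set"
  where "normal_words n R = {w \<in> words n. \<forall>g\<in>R. \<not> sublist (LM g) w}"


subsection \<open>The quotient algebra\<close>

definition quot_algebra :: "nat \<Rightarrow> 'k::field ncpoly set \<Rightarrow> 'k ncpoly set ring"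
  where "quot_algebra n I = free_algebra n Quot I"

definition quot_scalar :: "nat \<Rightarrow> 'k::field ncpoly set \<Rightarrow> 'k \<Rightarrow> 'k ncpoly set"
  where "quot_scalar n I c = I +>\<^bsub>free_algebra n\<^esub> const c"

definition quot_component :: "nat \<Rightarrow> 'k::field ncpoly set \<Rightarrow> nat \<Rightarrow> 'k ncpoly set set"
  where "quot_component n I d =
    (\<lambda>f. I +>\<^bsub>free_algebra n\<^esub> f) ` {f \<in> carrier (free_algebra n). homogeneous d f}"

text \<open>
  \<open>component_dim n I d N\<close>: the degree \<open>d\<close> component of the quotient has dimension \<open>N\<close> over the copy
  of the ground field consisting of the classes of the constants.
\<close>

definition component_dim :: "nat \<Rightarrow> 'k::field ncpoly set \<Rightarrow> nat \<Rightarrow> nat \<Rightarrow> bool"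
  where "component_dim n I d N \<longleftrightarrow>
    ring.dimension (quot_algebra n I) N (range (quot_scalar n I)) (quot_component n I d)"

text \<open>
  A graded algebra is given by a ring \<open>A\<close>, its structure map \<open>\<iota>\<close> from the ground field, and its
  homogeneous components \<open>C d\<close>.  The presentation is an isomorphism of graded algebras, so the
  generators \<open>x\<^sub>0, \<dots>, x\<^sub>m\<close> have degree one; the enumeration of the generators is the one given by
  their indices.
\<close>

definition pbw_algebra ::
  "('a, 'b) ring_scheme \<Rightarrow> ('k::field \<Rightarrow> 'a) \<Rightarrow> (nat \<Rightarrow> 'a set) \<Rightarrow> bool"
  where "pbw_algebra A \<iota> C \<longleftrightarrow>
    (\<exists>m (R :: 'k ncpoly set) \<phi>.
       R \<subseteq> carrier (free_algebra m) \<and> (\<forall>f\<in>R. homogeneous 2 f) \<and>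
       groebner_basis m R (Idl\<^bsub>free_algebra m\<^esub> R) \<and>
       \<phi> \<in> ring_iso (quot_algebra m (Idl\<^bsub>free_algebra m\<^esub> R)) A \<and>
       (\<forall>c. \<phi> (quot_scalar m (Idl\<^bsub>free_algebra m\<^esub> R) c) = \<iota> c) \<and>
       (\<forall>d. \<phi> ` quot_component m (Idl\<^bsub>free_algebra m\<^esub> R) d = C d))"


subsection \<open>Relations, reductions and ambiguities\<close>

definition relator :: "(nat \<Rightarrow> nat \<Rightarrow> 'k::field ncpoly) \<Rightarrow> nat \<Rightarrow> nat \<Rightarrow> 'k ncpoly"
  where "relator h j i = mon [j, i] - h j i"

definition relators :: "(nat \<times> nat) set \<Rightarrow> (nat \<Rightarrow> nat \<Rightarrow> 'k::field ncpoly) \<Rightarrow> 'k ncpoly set"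
  where "relators M h = {relator h j i | j i. (j, i) \<in> M}"

definition linear_extension :: "(word \<Rightarrow> 'k ncpoly) \<Rightarrow> 'k::field ncpoly \<Rightarrow> 'k ncpoly"
  where "linear_extension T f =
    (\<Sum>w\<in>Poly_Mapping.keys f. const (Poly_Mapping.lookup f w) * T w)"

definition reduction ::
  "(nat \<Rightarrow> nat \<Rightarrow> 'k::field ncpoly) \<Rightarrow> word \<Rightarrow> nat \<Rightarrow> nat \<Rightarrow> word \<Rightarrow> 'k ncpoly \<Rightarrow> 'k ncpoly"
  where "reduction h u j i v =
    linear_extension (\<lambda>w. if w = u @ [j, i] @ v then mon u * h j i * mon v else mon w)"

definition reduces ::
  "nat \<Rightarrow> (nat \<times> nat) set \<Rightarrow> (nat \<Rightarrow> nat \<Rightarrow> 'k::field ncpoly) \<Rightarrow> 'k ncpoly \<Rightarrow> 'k ncpoly \<Rightarrow> bool"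
  where "reduces n M h f g \<longleftrightarrow>
    (\<exists>u\<in>words n. \<exists>v\<in>words n. \<exists>(j, i)\<in>M. g = reduction h u j i v f)"

definition overlap_composition ::
  "(nat \<Rightarrow> nat \<Rightarrow> 'k::field ncpoly) \<Rightarrow> nat \<Rightarrow> nat \<Rightarrow> nat \<Rightarrow> 'k ncpoly"
  where "overlap_composition h k j i = relator h k j * mon [i] - mon [k] * relator h j i"

definition solvable_ambiguity ::
  "nat \<Rightarrow> (nat \<times> nat) set \<Rightarrow> (nat \<Rightarrow> nat \<Rightarrow> 'k::field ncpoly) \<Rightarrow> nat \<Rightarrow> nat \<Rightarrow> nat \<Rightarrow> bool"
  where "solvable_ambiguity n M h k j i \<longleftrightarrow>
    (reduces n M h)\<^sup>*\<^sup>* (overlap_composition h k j i) 0"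

end

theory Submission
  imports Defs
begin

text \<open>
  The ideal \<open>I\<close> is the span of the elements \<open>u f\<^sub>j\<^sub>i v\<close>.  If all overlaps are solvable, then two such
  elements with the same leading word \<open>W\<close> are congruent modulo those with leading word below \<open>W\<close>:
  for overlapping factors this is solvability, and for disjoint factors it follows from
  \<open>f m b' - b m f' = f m h' - h m f'\<close>, where \<open>f = b - h\<close> and \<open>f' = b' - h'\<close>.  Hence, by induction on a
  bound for the leading words in a representation of \<open>f \<in> I\<close>, the leading monomial of \<open>f\<close> is
  reducible.  Reductions terminate, so the normal words of length \<open>3\<close> always span \<open>A\<^sub>3\<close>, and
  \<open>dim A\<^sub>3\<close> equals their number iff they are independent modulo \<open>I\<close>; in that case a normal form of
  a composition, which lies in \<open>I\<close> and is supported on normal words of length \<open>3\<close>, must vanish.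
\<close>

subsection \<open>Words and monomials\<close>

lemma length_less_imp_less: "length x < length y \<Longrightarrow> x < y" for x y :: "'a::linorder list"
  by (cases x; cases y) (auto simp: Cons_less_Cons)

lemma less_imp_length_le: "x < y \<Longrightarrow> length x \<le> length y" for x y :: "'a::linorder list"
  by (meson length_less_imp_less less_asym not_le)

lemma append_less_appendI: "x < y \<Longrightarrow> u @ x < u @ y" for x y :: "'a::linorder list"
  using less_imp_length_le[of x y] by (induction u) (auto simp: Cons_less_Cons)

text \<open>Comparing lengths first is essential here: for \<open>x = []\<close> the word
  \<open>y @ v\<close> is longer than \<open>v\<close>, whereas the plain lexicographic order is not
  stable under appending on the right.\<close>

lemma append_less_append_rightI: "x < y \<Longrightarrow> x @ v < y @ v" for x y :: "'a::linorder list"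
proof (induction x arbitrary: y)
  case Nil
  then show ?case by (cases y) (auto intro: length_less_imp_less)
next
  case (Cons a x)
  then show ?case by (cases y) (auto simp: Cons_less_Cons)
qed

lemma sandwich_less: "x < y \<Longrightarrow> u @ x @ v < u @ y @ v" for x y :: "'a::linorder list"
  by (intro append_less_appendI append_less_append_rightI)

lemma sandwich_le: "x \<le> y \<Longrightarrow> u @ x @ v \<le> u @ y @ v" for x y :: "'a::linorder list"
  using sandwich_less[of x y u v] by (auto simp: order_le_less)

text \<open>Two factors of length two in one word coincide, share exactly one letter, or are
  disjoint. The middle case produces the ambiguities of overlap.\<close>

lemma two_factors_cases:
  assumes "u @ [a, b] @ v = u' @ [a', b'] @ v'" and "length u \<le> length u'"
  obtains (same) "u' = u" "a' = a" "b' = b" "v' = v"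
  | (overlap) "u' = u @ [a]" "a' = b" "v = b' # v'"
  | (disjoint) m where "u' = u @ [a, b] @ m" "v = m @ [a', b'] @ v'"
proof -
  obtain d where d: "u' = u @ d"
    using assms by (metis append_eq_append_conv_if append_eq_conv_conj)
  with assms have eq: "a # b # v = d @ a' # b' # v'"
    by simp
  \<comment> \<open>\<open>d\<close> is the stretch between the starting points of the factors; its
    length 0, 1, or at least 2 decides the case.\<close>
  show thesis
  proof (cases d)
    case Nil
    then show thesis using eq d same by auto
  next
    case (Cons x d')
    then show thesis using eq d overlap disjoint by (cases d') auto
  qed
qed

lemma words_append [simp]: "u @ v \<in> words n \<longleftrightarrow> u \<in> words n \<and> v \<in> words n"
  by (auto simp: words_def)

lemma words_Cons [simp]: "i # v \<in> words n \<longleftrightarrow> i \<le> n \<and> v \<in> words n"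
  by (auto simp: words_def)

lemma words_Nil [simp]: "[] \<in> words n"
  by (simp add: words_def)

lemma finite_words_of_length: "finite {w \<in> words n. length w = d}"
proof -
  have "{w \<in> words n. length w = d} = {w. set w \<subseteq> {0..n} \<and> length w = d}"
    by (auto simp: words_def in_lists_conv_set)
  then show ?thesis
    by (simp add: finite_lists_length_eq)
qed

section \<open>Monomials, constants and supports in the free algebra\<close>

lemma mon_mult: "mon u * mon v = mon (u @ v)"
  by (simp add: mult_single plus_list_def)

lemma const_mult_mon: "const c * mon w = Poly_Mapping.single w c"
  by (simp add: mult_single plus_list_def)

lemma lookup_const_mult: "Poly_Mapping.lookup (const c * f) w = c * Poly_Mapping.lookup f w"
proof -
  have "const c * f = Poly_Mapping.map ((*) c) f"
    by (simp add: mult_map_scale_conv_mult zero_list_def)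
  then show ?thesis
    by (simp add: Poly_Mapping.map.rep_eq when_def)
qed

lemma keys_const_mult: "Poly_Mapping.keys (const c * f) \<subseteq> Poly_Mapping.keys f"
  by (auto simp: in_keys_iff lookup_const_mult)

lemma keys_minus_subset:
  "Poly_Mapping.keys (f - g) \<subseteq> Poly_Mapping.keys f \<union> Poly_Mapping.keys g"
  for f g :: "'a \<Rightarrow>\<^sub>0 'b::ab_group_add"
  by (auto simp: in_keys_iff lookup_minus)

lemma const_one: "const 1 = 1"
  by (metis single_one zero_list_def)

lemma const_mult_const: "const a * const b = const (a * b)"
  by (simp add: mult_single plus_list_def)

lemma sum_monomials: "(\<Sum>w\<in>Poly_Mapping.keys f. const (Poly_Mapping.lookup f w) * mon w) = f"
  by (rule poly_mapping_eqI)
    (simp add: const_mult_mon lookup_sum lookup_single when_def in_keys_iff)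

lemma const_commute: "const c * f = f * const c"
proof -
  have "const c * const a * mon w = const a * mon w * const c" for a and w :: word
    by (simp add: mult_single plus_list_def mult.commute)
  then have "const c * (\<Sum>w\<in>Poly_Mapping.keys f. const (Poly_Mapping.lookup f w) * mon w) =
      (\<Sum>w\<in>Poly_Mapping.keys f. const (Poly_Mapping.lookup f w) * mon w) * const c"
    by (simp add: sum_distrib_left sum_distrib_right mult.assoc)
  then show ?thesis
    by (simp only: sum_monomials)
qed

lemma const_left_commute: "p * (const c * f) = const c * (p * f)"
  by (metis const_commute mult.assoc)

lemma keys_sandwich:
  "Poly_Mapping.keys (mon u * f * mon v) \<subseteq> (\<lambda>w. u @ w @ v) ` Poly_Mapping.keys f"
  using keys_mult[of "mon u * f" "mon v"] keys_mult[of "mon u" f]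
  by (fastforce simp: plus_list_def image_iff)

lemma LM_eqI:
  assumes "w \<in> Poly_Mapping.keys f" and "\<And>w'. w' \<in> Poly_Mapping.keys f \<Longrightarrow> w' \<le> w"
  shows "LM f = w"
  unfolding LM_def using assms by (intro Max_eqI) auto

lemma LM_in_keys: "f \<noteq> 0 \<Longrightarrow> LM f \<in> Poly_Mapping.keys f"
  by (auto simp: LM_def)

lemma LM_greatest: "w \<in> Poly_Mapping.keys f \<Longrightarrow> w \<le> LM f"
  by (auto simp: LM_def)

lemma uminus_free_algebra:
  fixes f :: "'k::field ncpoly"
  assumes "f \<in> carrier (free_algebra n)"
  shows "\<ominus>\<^bsub>free_algebra n\<^esub> f = - f"
proof -
  interpret F: ring "free_algebra n :: 'k ncpoly ring"
    by (rule ring_free_algebra)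
  show ?thesis
    using assms by (intro F.minus_equality) (auto simp: free_algebra_def)
qed


subsection \<open>Spans of two-sided multiples of the relators\<close>

text \<open>\<open>S\<close> restricts the leading words of the multiples in a representation, not
  merely the support of the sum. Thus \<open>S = words n\<close> will give the whole ideal, and sets
  of words below \<open>W\<close> give a filtration of it. Adding one scalar multiple at a time
  provides induction over representations.\<close>

inductive_set relation_span ::
    "(nat \<times> nat) set \<Rightarrow> (nat \<Rightarrow> nat \<Rightarrow> 'k::field ncpoly) \<Rightarrow> word set \<Rightarrow> 'k ncpoly set"
  for M h S
  where
    zero: "0 \<in> relation_span M h S"
  | step: "f \<in> relation_span M h S \<Longrightarrow> (j, i) \<in> M \<Longrightarrow> u @ [j, i] @ v \<in> S \<Longrightarrow>
      f + const c * (mon u * relator h j i * mon v) \<in> relation_span M h S"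

lemma relation_span_mono:
  "f \<in> relation_span M h S \<Longrightarrow> S \<subseteq> T \<Longrightarrow> f \<in> relation_span M h T"
  by (induction rule: relation_span.induct) (blast intro: relation_span.intros)+

lemma relation_span_add:
  assumes "f \<in> relation_span M h S"
  shows "g \<in> relation_span M h S \<Longrightarrow> f + g \<in> relation_span M h S"
proof (induction rule: relation_span.induct)
  case zero
  then show ?case using assms by simp
next
  case (step g j i u v c)
  then show ?case
    using relation_span.step[of "f + g" M h S j i u v c] by (simp add: add.assoc)
qed

lemma relation_span_const_mult:
  "f \<in> relation_span M h S \<Longrightarrow> const a * f \<in> relation_span M h S"
proof (induction rule: relation_span.induct)
  case zero
  then show ?case by (simp add: relation_span.zero)
next
  case (step f j i u v c)
  then show ?case
    using relation_span.step[of "const a * f" M h S j i u v "a * c"]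
    by (simp add: distrib_left const_mult_const flip: mult.assoc)
qed

lemma relation_span_uminus: "f \<in> relation_span M h S \<Longrightarrow> - f \<in> relation_span M h S"
  using relation_span_const_mult[of f M h S "-1"] by (simp add: single_uminus const_one)

lemma relation_span_diff:
  "f \<in> relation_span M h S \<Longrightarrow> g \<in> relation_span M h S \<Longrightarrow> f - g \<in> relation_span M h S"
  using relation_span_add[OF _ relation_span_uminus, of f M h S g] by simp

lemma relation_span_generator:
  "(j, i) \<in> M \<Longrightarrow> u @ [j, i] @ v \<in> S \<Longrightarrow> mon u * relator h j i * mon v \<in> relation_span M h S"
  using relation_span.step[OF relation_span.zero, of j i M u v S 1 h] by (simp add: const_one)

lemma relation_span_sum:
  "(\<And>w. w \<in> A \<Longrightarrow> g w \<in> relation_span M h S) \<Longrightarrow> sum g A \<in> relation_span M h S"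
  by (induction A rule: infinite_finite_induct) (auto intro: relation_span.zero relation_span_add)

text \<open>By linearity in the middle factor, it is enough to treat each of its words
  separately.\<close>

lemma relation_span_expand:
  assumes "\<And>w. w \<in> Poly_Mapping.keys g \<Longrightarrow> p * mon w * q \<in> relation_span M h S"
  shows "p * g * q \<in> relation_span M h S"
proof -
  have "(\<Sum>w\<in>Poly_Mapping.keys g. const (Poly_Mapping.lookup g w) * (p * mon w * q)) =
      p * (\<Sum>w\<in>Poly_Mapping.keys g. const (Poly_Mapping.lookup g w) * mon w) * q"
    by (simp add: sum_distrib_left sum_distrib_right mult.assoc const_left_commute del: single_diff)
  then have "p * g * q =
      (\<Sum>w\<in>Poly_Mapping.keys g. const (Poly_Mapping.lookup g w) * (p * mon w * q))"
    by (simp only: sum_monomials)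
  then show ?thesis
    using assms by (auto intro: relation_span_sum relation_span_const_mult)
qed

text \<open>Multiplication by monomials shifts the leading words of a representation, so a bound by
  \<open>[k, j, i]\<close> turns into a bound by \<open>a @ [k, j, i] @ b\<close>.\<close>

lemma relation_span_sandwich:
  assumes "f \<in> relation_span M h S" and "\<And>w. w \<in> S \<Longrightarrow> a @ w @ b \<in> T"
  shows "mon a * f * mon b \<in> relation_span M h T"
  using assms(1)
proof (induction rule: relation_span.induct)
  case zero
  then show ?case by (simp add: relation_span.zero)
next
  case (step f j i u v c)
  have "mon a * (const c * (mon u * relator h j i * mon v)) * mon b =
      const c * (mon (a @ u) * relator h j i * mon (v @ b))"
    by (simp add: mult.assoc const_left_commute flip: mon_mult)
  then have "mon a * (f + const c * (mon u * relator h j i * mon v)) * mon b =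
      mon a * f * mon b + const c * (mon (a @ u) * relator h j i * mon (v @ b))"
    by (simp add: distrib_left distrib_right)
  moreover have "(a @ u) @ [j, i] @ (v @ b) \<in> T"
    using assms(2)[OF step.hyps(3)] by simp
  ultimately show ?case
    using relation_span.step[OF step.IH step.hyps(2)] by metis
qed

text \<open>A representation has finitely many terms, so a largest leading word can serve as
  \<open>W\<close>. The zero polynomial is listed apart because \<open>S\<close> may be empty. This
  supplies the bound on which the induction for leading monomials runs.\<close>

lemma relation_span_bounded:
  "f \<in> relation_span M h S \<Longrightarrow> f = 0 \<or> (\<exists>W\<in>S. f \<in> relation_span M h {w \<in> S. w \<le> W})"
proof (induction rule: relation_span.induct)
  case zero
  then show ?case by simp
next
  case (step f j i u v c)
  let ?w = "u @ [j, i] @ v"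
  have "\<exists>W\<in>S. f \<in> relation_span M h {w \<in> S. w \<le> W} \<and> ?w \<le> W"
  proof (cases "f = 0")
    case True
    then show ?thesis using step.hyps(3) by (auto intro: relation_span.zero)
  next
    case False
    then obtain W where W: "W \<in> S" "f \<in> relation_span M h {w \<in> S. w \<le> W}"
      using step.IH by blast
    have "f \<in> relation_span M h {w \<in> S. w \<le> max W ?w}"
      using W(2) by (rule relation_span_mono) (auto simp: le_max_iff_disj)
    then show ?thesis
      using W(1) step.hyps(3) by (intro bexI[of _ "max W ?w"]) (auto simp: max_def)
  qed
  then obtain W where "W \<in> S" "f \<in> relation_span M h {w \<in> S. w \<le> W}" "?w \<le> W"
    by blast
  then show ?case
    using step.hyps by (intro disjI2 bexI[of _ W] relation_span.step) auto
qed

section \<open>Reductions as subtraction of relator multiples\<close>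

text \<open>The operator alters a single word, from which it subtracts the corresponding multiple of
  \<open>relator h j i\<close>; linearity scales this by the coefficient of that word.\<close>

lemma reduction_eq:
  "reduction h u j i v f =
    f - const (Poly_Mapping.lookup f (u @ [j, i] @ v)) * (mon u * relator h j i * mon v)"
proof -
  let ?W = "u @ [j, i] @ v"
  let ?T = "\<lambda>w. if w = ?W then mon u * h j i * mon v else mon w"
  have "?T w = mon w - (if w = ?W then mon u * relator h j i * mon v else 0)" for w
    by (simp add: relator_def right_diff_distrib left_diff_distrib mon_mult)
  then have "linear_extension ?T f =
      (\<Sum>w\<in>Poly_Mapping.keys f. const (Poly_Mapping.lookup f w) * mon w) -
      (\<Sum>w\<in>Poly_Mapping.keys f. const (Poly_Mapping.lookup f w) *
         (if w = ?W then mon u * relator h j i * mon v else 0))"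
    unfolding linear_extension_def by (simp only: right_diff_distrib sum_subtractf)
  also have "(\<Sum>w\<in>Poly_Mapping.keys f. const (Poly_Mapping.lookup f w) *
         (if w = ?W then mon u * relator h j i * mon v else 0)) =
      const (Poly_Mapping.lookup f ?W) * (mon u * relator h j i * mon v)"
    by (simp add: if_distrib[of "\<lambda>x. _ * x"] in_keys_iff cong: if_cong)
  finally show ?thesis
    unfolding reduction_def sum_monomials .
qed

text \<open>Either the subtracted multiple has its leading word in the support of \<open>f\<close>,
  or its coefficient is zero. Hence bounds on the words of \<open>f\<close> become bounds on the
  representation of the difference.\<close>

lemma reduction_diff_in_relation_span:
  assumes "(j, i) \<in> M"
  shows "f - reduction h u j i v f \<in> relation_span M h (Poly_Mapping.keys f)"
proof (cases "u @ [j, i] @ v \<in> Poly_Mapping.keys f")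
  case True
  then show ?thesis
    using assms unfolding reduction_eq
    by (simp add: relation_span_const_mult relation_span_generator)
next
  case False
  then show ?thesis
    by (simp add: reduction_eq in_keys_iff relation_span.zero)
qed


subsection \<open>Quadratic relations\<close>

text \<open>\<open>h_keys\<close> speaks about every word of \<open>h j i\<close> instead of its
  leading monomial, so the case \<open>h j i = 0\<close> needs no separate treatment.\<close>

locale quadratic_relations =
  fixes n :: nat and M :: "(nat \<times> nat) set" and h :: "nat \<Rightarrow> nat \<Rightarrow> 'k::field ncpoly"
  assumes M_le: "(j, i) \<in> M \<Longrightarrow> j \<le> n \<and> i \<le> n"
    and h_keys: "(j, i) \<in> M \<Longrightarrow> w \<in> Poly_Mapping.keys (h j i) \<Longrightarrow>
      w \<in> words n \<and> length w = 2 \<and> w < [j, i]"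
begin

abbreviation span_of where "span_of \<equiv> relation_span M h"

lemma relator_keys:
  assumes "(j, i) \<in> M" and "w \<in> Poly_Mapping.keys (relator h j i)"
  shows "w \<in> words n \<and> length w = 2 \<and> w \<le> [j, i]"
proof -
  have "w = [j, i] \<or> w \<in> Poly_Mapping.keys (h j i)"
    using assms(2) keys_minus_subset[of "mon [j, i]" "h j i"] by (auto simp: relator_def)
  then show ?thesis
    using h_keys[OF assms(1), of w] M_le[OF assms(1)] by (auto intro: less_imp_le)
qed

lemma lookup_relator: "(j, i) \<in> M \<Longrightarrow> Poly_Mapping.lookup (relator h j i) [j, i] = 1"
  using h_keys[of j i "[j, i]"] by (auto simp: relator_def lookup_minus in_keys_iff)

lemma LM_relator: "(j, i) \<in> M \<Longrightarrow> LM (relator h j i) = [j, i]"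
  using relator_keys lookup_relator by (intro LM_eqI) (auto simp: in_keys_iff)

lemma relator_in_carrier: "(j, i) \<in> M \<Longrightarrow> relator h j i \<in> carrier (free_algebra n)"
  using relator_keys by (auto simp: free_algebra_def)

lemma relators_subset_carrier: "relators M h \<subseteq> carrier (free_algebra n)"
  using relator_in_carrier by (auto simp: relators_def)

lemma relator_multiple_keys:
  assumes "(j, i) \<in> M" and "u @ [j, i] @ v \<in> words n"
    and "w \<in> Poly_Mapping.keys (mon u * relator h j i * mon v)"
  shows "w \<in> words n \<and> w \<le> u @ [j, i] @ v \<and> length w = length (u @ [j, i] @ v)"
proof -
  obtain w' where "w' \<in> Poly_Mapping.keys (relator h j i)" "w = u @ w' @ v"
    using assms(3) keys_sandwich[of u "relator h j i" v] by blast
  then show ?thesis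
    using relator_keys[OF assms(1)] assms(2) sandwich_le[of w' "[j, i]" u v] by simp
qed

text \<open>The words of \<open>h j i\<close> differ from \<open>[j, i]\<close>, and still do so
  inside the context \<open>u\<close>, \<open>v\<close>; the leading term therefore cannot
  cancel.\<close>

lemma lookup_relator_multiple:
  assumes "(j, i) \<in> M"
  shows "Poly_Mapping.lookup (mon u * relator h j i * mon v) (u @ [j, i] @ v) = 1"
proof -
  have "u @ [j, i] @ v \<notin> Poly_Mapping.keys (mon u * h j i * mon v)"
    using keys_sandwich[of u "h j i" v] h_keys[OF assms, of "[j, i]"] by auto
  moreover have "mon u * relator h j i * mon v = mon (u @ [j, i] @ v) - mon u * h j i * mon v"
    by (simp add: relator_def right_diff_distrib left_diff_distrib mon_mult)
  ultimately show ?thesis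
    by (simp add: lookup_minus in_keys_iff)
qed

text \<open>The relators are homogeneous with leading word \<open>[j, i]\<close>, so a multiple only
  has words of the same length as its leading word and not above it.\<close>

lemma span_keys:
  assumes "f \<in> span_of S" and "S \<subseteq> words n"
  shows "w \<in> Poly_Mapping.keys f \<Longrightarrow> w \<in> words n \<and> (\<exists>W\<in>S. w \<le> W \<and> length w = length W)"
  using assms(1)
proof (induction rule: relation_span.induct)
  case zero
  then show ?case by simp
next
  case (step f j i u v c)
  have word: "u @ [j, i] @ v \<in> words n"
    using step.hyps(3) assms(2) by blast
  consider "w \<in> Poly_Mapping.keys f" | "w \<in> Poly_Mapping.keys (mon u * relator h j i * mon v)"
    using step.prems keys_const_mult
      keys_add[of f "const c * (mon u * relator h j i * mon v)"] by blast
  then show ?case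
    using step.IH step.hyps(3) relator_multiple_keys[OF step.hyps(2) word] by metis
qed

text \<open>A reduction creates only words of the same length that are not larger, hence the closure
  condition on \<open>S\<close>. It is applied to the words below an ambiguity, to bound a
  representation, and to the words of a fixed length, to preserve homogeneity.\<close>

lemma reduces_rtranclp_span:
  assumes "(reduces n M h)\<^sup>*\<^sup>* f g" and "Poly_Mapping.keys f \<subseteq> S" and "S \<subseteq> words n"
    and closed: "\<And>w W. W \<in> S \<Longrightarrow> w \<in> words n \<Longrightarrow> w \<le> W \<Longrightarrow> length w = length W \<Longrightarrow> w \<in> S"
  shows "f - g \<in> span_of S \<and> Poly_Mapping.keys g \<subseteq> S"
  using assms(1)
proof (induction rule: rtranclp_induct)
  case base
  then show ?case using assms(2) by (simp add: relation_span.zero)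
next
  case (step g g')
  then have "g - g' \<in> span_of (Poly_Mapping.keys g)"
    using reduction_diff_in_relation_span by (fastforce simp: reduces_def)
  then have diff: "g - g' \<in> span_of S"
    using step.IH relation_span_mono by blast
  have "Poly_Mapping.keys g' \<subseteq> Poly_Mapping.keys g \<union> Poly_Mapping.keys (g - g')"
    using keys_minus_subset[of g "g - g'"] by simp
  then have "Poly_Mapping.keys g' \<subseteq> S"
    using step.IH span_keys[OF diff assms(3)] closed by blast
  moreover have "f - g' = (f - g) + (g - g')"
    by simp
  ultimately show ?case
    using step.IH diff relation_span_add by metis
qed


subsection \<open>The ideal generated by the relators\<close>

lemma span_of_carrier: "f \<in> span_of (words n) \<Longrightarrow> f \<in> carrier (free_algebra n)"
  using span_keys[of f "words n"] by (auto simp: free_algebra_def)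

lemma ideal_span_of: "ideal (span_of (words n)) (free_algebra n)"
proof (rule idealI[OF ring_free_algebra])
  interpret F: ring "free_algebra n :: 'k ncpoly ring"
    by (rule ring_free_algebra)
  show "subgroup (span_of (words n)) (add_monoid (free_algebra n))"
  proof (rule F.add.subgroupI)
    show "span_of (words n) \<subseteq> carrier (free_algebra n)"
      using span_of_carrier by blast
    show "span_of (words n) \<noteq> {}"
      using relation_span.zero by blast
    fix f g assume f: "f \<in> span_of (words n)" and g: "g \<in> span_of (words n)"
    show "\<ominus>\<^bsub>free_algebra n\<^esub> f \<in> span_of (words n)"
      using relation_span_uminus[OF f] uminus_free_algebra[OF span_of_carrier[OF f]] by simp
    show "f \<oplus>\<^bsub>free_algebra n\<^esub> g \<in> span_of (words n)"
      using relation_span_add[OF f g] by (simp add: free_algebra_def)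
  qed
next
  fix f g :: "'k ncpoly"
  assume f: "f \<in> span_of (words n)" and "g \<in> carrier (free_algebra n)"
  then have g: "w \<in> words n" if "w \<in> Poly_Mapping.keys g" for w
    using that by (auto simp: free_algebra_def)
  \<comment> \<open>The factor \<open>1\<close> gives the product the three-factor shape of
    \<open>relation_span_expand\<close>, with \<open>g\<close> in the middle.\<close>
  have "1 * g * f \<in> span_of (words n)"
  proof (rule relation_span_expand)
    fix w assume "w \<in> Poly_Mapping.keys g"
    then have "mon w * f * mon [] \<in> span_of (words n)"
      using g by (intro relation_span_sandwich[OF f]) simp
    then show "1 * mon w * f \<in> span_of (words n)"
      by (simp only: const_one mult_1 mult_1_right)
  qed
  then show "g \<otimes>\<^bsub>free_algebra n\<^esub> f \<in> span_of (words n)"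
    by (simp add: free_algebra_def)
  have "f * g * 1 \<in> span_of (words n)"
  proof (rule relation_span_expand)
    fix w assume "w \<in> Poly_Mapping.keys g"
    then have "mon [] * f * mon w \<in> span_of (words n)"
      using g by (intro relation_span_sandwich[OF f]) simp
    then show "f * mon w * 1 \<in> span_of (words n)"
      by (simp only: const_one mult_1 mult_1_right)
  qed
  then show "f \<otimes>\<^bsub>free_algebra n\<^esub> g \<in> span_of (words n)"
    by (simp add: free_algebra_def)
qed

text \<open>This gives elements of the abstractly generated ideal explicit representations, on which
  induction is possible.\<close>

lemma genideal_relators: "Idl\<^bsub>free_algebra n\<^esub> (relators M h) = span_of (words n)"
proof
  interpret F: ring "free_algebra n :: 'k ncpoly ring"
    by (rule ring_free_algebra)
  let ?I = "Idl\<^bsub>free_algebra n\<^esub> (relators M h)"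
  have "relators M h \<subseteq> span_of (words n)"
    using relation_span_generator[of _ _ M "[]" "[]" "words n" h] M_le
    by (auto simp: relators_def const_one)
  then show "?I \<subseteq> span_of (words n)"
    by (intro F.genideal_minimal ideal_span_of)
  interpret I: ideal ?I "free_algebra n :: 'k ncpoly ring"
    by (intro F.genideal_ideal relators_subset_carrier)
  show "span_of (words n) \<subseteq> ?I"
  proof
    fix f assume "f \<in> span_of (words n)"
    then show "f \<in> ?I"
    proof (induction rule: relation_span.induct)
      case zero
      then show ?case using I.zero_closed by (simp add: free_algebra_def)
    next
      case (step f j i u v c)
      have rel: "relator h j i \<in> ?I"
        using step.hyps(2) F.genideal_self[OF relators_subset_carrier] by (auto simp: relators_def)
      have mons: "mon u \<in> carrier (free_algebra n)" "mon v \<in> carrier (free_algebra n)"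
        "const c \<in> carrier (free_algebra n)"
        using step.hyps(3) by (auto simp: free_algebra_def)
      have "const c \<otimes>\<^bsub>free_algebra n\<^esub> (mon u \<otimes>\<^bsub>free_algebra n\<^esub> relator h j i \<otimes>\<^bsub>free_algebra n\<^esub> mon v) \<in> ?I"
        by (intro I.I_l_closed I.I_r_closed rel mons)
      then show ?case
        using I.a_closed[OF step.IH] by (simp add: free_algebra_def)
    qed
  qed
qed


subsection \<open>Leading monomials in the ideal\<close>

definition reducible :: "word \<Rightarrow> bool"
  where "reducible w \<longleftrightarrow> (\<exists>(j, i)\<in>M. sublist [j, i] w)"

lemma reducible_iff: "reducible w \<longleftrightarrow> (\<exists>u j i v. (j, i) \<in> M \<and> w = u @ [j, i] @ v)"
  by (auto simp: reducible_def sublist_def)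

lemma LM_relators_sublist_iff: "(\<exists>g\<in>relators M h. sublist (LM g) w) \<longleftrightarrow> reducible w"
proof
  assume "\<exists>g\<in>relators M h. sublist (LM g) w"
  then obtain j i where "(j, i) \<in> M" "sublist (LM (relator h j i)) w"
    unfolding relators_def by blast
  then show "reducible w"
    using LM_relator[of j i] by (auto simp: reducible_def)
next
  assume "reducible w"
  then obtain j i where "(j, i) \<in> M" "sublist [j, i] w"
    unfolding reducible_def by blast
  then show "\<exists>g\<in>relators M h. sublist (LM g) w"
    using LM_relator[of j i] unfolding relators_def
    by (intro bexI[of _ "relator h j i"]) auto
qed

lemma normal_words_relators:
  "normal_words n (relators M h) = {w \<in> words n. \<not> reducible w}"
  unfolding normal_words_def LM_relators_sublist_iff[symmetric] by blast

lemma monic_relator: "(j, i) \<in> M \<Longrightarrow> monic (relator h j i)"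
  using lookup_relator[of j i] LM_relator[of j i] unfolding monic_def by force

text \<open>The relators are monic and generate the ideal by construction, so only the condition on
  leading monomials remains.\<close>

lemma groebner_basis_relators_iff:
  "groebner_basis n (relators M h) (Idl\<^bsub>free_algebra n\<^esub> (relators M h)) \<longleftrightarrow>
    (\<forall>f\<in>span_of (words n). f \<noteq> 0 \<longrightarrow> reducible (LM f))"
proof -
  have "\<forall>g\<in>relators M h. monic g"
    unfolding relators_def using monic_relator by blast
  moreover have "relators M h \<subseteq> Idl\<^bsub>free_algebra n\<^esub> (relators M h)"
    by (intro ring.genideal_self ring_free_algebra relators_subset_carrier)
  ultimately show ?thesis
    unfolding groebner_basis_def LM_relators_sublist_iff genideal_relators by blast
qed

text \<open>The common leading word \<open>W\<close> cancels in the difference, but more is needed: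
  a representation whose individual terms all have leading words below \<open>W\<close>.\<close>

lemma relator_multiples_congruent:
  assumes overlaps: "\<And>k j i. (k, j) \<in> M \<Longrightarrow> (j, i) \<in> M \<Longrightarrow>
      overlap_composition h k j i \<in> span_of {w \<in> words n. w < [k, j, i]}"
    and "(j, i) \<in> M" "(j', i') \<in> M"
    and "u @ [j, i] @ v = W" "u' @ [j', i'] @ v' = W" "W \<in> words n"
  shows "mon u * relator h j i * mon v - mon u' * relator h j' i' * mon v'
    \<in> span_of {w \<in> words n. w < W}"
proof -
  let ?J = "span_of {w \<in> words n. w < W}"
  \<comment> \<open>The factor starting further left is taken first; the opposite order follows by
    negation.\<close>
  have ordered: "mon u * relator h j i * mon v - mon u' * relator h j' i' * mon v' \<in> ?J"
    if "(j, i) \<in> M" "(j', i') \<in> M"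
      and W: "u @ [j, i] @ v = W" "u' @ [j', i'] @ v' = W" and "length u \<le> length u'"
    for j i j' i' u v u' v'
    using trans[OF W(1) W(2)[symmetric]] \<open>length u \<le> length u'\<close>
  proof (cases rule: two_factors_cases)
    case same
    then show ?thesis by (simp add: relation_span.zero)
  next
    case overlap
    \<comment> \<open>The two factors together cover \<open>[j, i, i']\<close>, and the difference
      of the multiples is the composition of overlap placed between \<open>u\<close> and
      \<open>v'\<close>.\<close>
    have "mon u * overlap_composition h j i i' * mon v' \<in> ?J"
    proof (rule relation_span_sandwich)
      show "overlap_composition h j i i' \<in> span_of {w \<in> words n. w < [j, i, i']}"
        using overlaps that overlap by simp
      show "u @ w @ v' \<in> {w \<in> words n. w < W}" if "w \<in> {w \<in> words n. w < [j, i, i']}" for w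
        using that sandwich_less[of w "[j, i, i']" u v'] W overlap \<open>W \<in> words n\<close> by auto
    qed
    moreover have "mon u * overlap_composition h j i i' * mon v' =
        mon u * relator h j i * mon v - mon u' * relator h j' i' * mon v'"
      using overlap
      by (simp add: overlap_composition_def right_diff_distrib left_diff_distrib mult.assoc
          flip: mon_mult[of u "[j]"] mon_mult[of "[i']" v', simplified])
    ultimately show ?thesis by simp
  next
    case (disjoint m)
    have word: "[j, i] \<in> words n" "[j', i'] \<in> words n" "u \<in> words n" "v' \<in> words n" "m \<in> words n"
      using \<open>W \<in> words n\<close> W disjoint by auto
    \<comment> \<open>Replacing one of the disjoint factors by a word of the corresponding
      \<open>h\<close> strictly lowers the whole word; \<open>second\<close> does the same with the
      roles exchanged.\<close>
    have first: "mon u * relator h j i * mon m * h j' i' * mon v' \<in> ?J"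
    proof (rule relation_span_expand)
      fix w assume w: "w \<in> Poly_Mapping.keys (h j' i')"
      have "u @ [j, i] @ (m @ w @ v') < W"
        using h_keys[OF that(2) w] sandwich_less[of w "[j', i']" "u @ [j, i] @ m" v'] W disjoint
        by simp
      then have "mon u * relator h j i * mon (m @ w @ v') \<in> ?J"
        using h_keys[OF that(2) w] word that(1) by (intro relation_span_generator) auto
      then show "mon u * relator h j i * mon m * mon w * mon v' \<in> ?J"
        by (simp add: mult.assoc mon_mult)
    qed
    have second: "mon u * h j i * (mon m * relator h j' i' * mon v') \<in> ?J"
    proof (rule relation_span_expand)
      fix w assume w: "w \<in> Poly_Mapping.keys (h j i)"
      have "(u @ w @ m) @ [j', i'] @ v' < W"
        using h_keys[OF that(1) w] sandwich_less[of w "[j, i]" u "m @ [j', i'] @ v'"] W disjoint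
        by simp
      then have "mon (u @ w @ m) * relator h j' i' * mon v' \<in> ?J"
        using h_keys[OF that(1) w] word that(2) by (intro relation_span_generator) auto
      then show "mon u * mon w * (mon m * relator h j' i' * mon v') \<in> ?J"
        by (simp add: mult.assoc flip: mon_mult)
    qed
    \<comment> \<open>The identity for disjoint factors in generic letters. The grouping
      \<open>m * B * v\<close> on the left matches \<open>v = m @ [j', i'] @ v'\<close>, and
      \<open>u * A * m\<close> matches \<open>u' = u @ [j, i] @ m\<close>.\<close>
    have "u * (A - H) * (m * B * v) - u * A * m * (B - H') * v =
        u * (A - H) * m * H' * v - u * H * (m * (B - H') * v)"
      for u A H m B H' v :: "'k ncpoly"
      by (simp add: right_diff_distrib left_diff_distrib mult.assoc)
    from this[of "mon u" "mon [j, i]" "h j i" "mon m" "mon [j', i']" "mon v'" "h j' i'"]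
    have "mon u * relator h j i * mon v - mon u' * relator h j' i' * mon v' =
        mon u * relator h j i * mon m * h j' i' * mon v' -
        mon u * h j i * (mon m * relator h j' i' * mon v')"
      unfolding relator_def disjoint mon_mult append_assoc .
    then show ?thesis
      using relation_span_diff[OF first second] by (simp only:)
  qed
  show ?thesis
  proof (cases "length u \<le> length u'")
    case True
    then show ?thesis using ordered assms by blast
  next
    case False
    then show ?thesis
      using relation_span_uminus[OF ordered[of j' i' j i u' v' u v]] assms by simp
  qed
qed

text \<open>All terms with leading word \<open>W\<close> are merged into one. If it has a nonzero
  coefficient, \<open>W\<close> is the leading monomial; otherwise a smaller bound suffices and
  well-founded induction applies.\<close>

lemma LM_reducible_of_bounded:
  assumes overlaps: "\<And>k j i. (k, j) \<in> M \<Longrightarrow> (j, i) \<in> M \<Longrightarrow>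
      overlap_composition h k j i \<in> span_of {w \<in> words n. w < [k, j, i]}"
  shows "f \<in> span_of {w \<in> words n. w \<le> W} \<Longrightarrow> f \<noteq> 0 \<Longrightarrow> reducible (LM f)"
proof (induction W arbitrary: f rule: less_induct)
  case (less W)
  let ?J = "span_of {w \<in> words n. w < W}"
  have below: "reducible (LM f)" if "f \<in> ?J"
  proof -
    obtain W' where "W' \<in> words n" "W' < W"
      and f: "f \<in> span_of {w \<in> {w \<in> words n. w < W}. w \<le> W'}"
      using relation_span_bounded[OF \<open>f \<in> ?J\<close>] less.prems(2) by blast
    moreover have "f \<in> span_of {w \<in> words n. w \<le> W'}"
      using f by (rule relation_span_mono) auto
    ultimately show ?thesis
      using less.IH less.prems(2) by blast
  qed
  \<comment> \<open>A representation can be rearranged so that at most one multiple has leading word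
    \<open>W\<close>.\<close>
  have "f \<in> ?J \<or> (\<exists>u j i v c. (j, i) \<in> M \<and> u @ [j, i] @ v = W \<and> W \<in> words n \<and>
      f - const c * (mon u * relator h j i * mon v) \<in> ?J)" (is "?P f")
    using less.prems(1)
  proof (induction rule: relation_span.induct)
    case zero
    then show ?case by (simp add: relation_span.zero)
  next
    case (step f j i u v c)
    let ?g = "mon u * relator h j i * mon v"
    show ?case
    proof (cases "u @ [j, i] @ v = W")
      case False
      then have g: "const c * ?g \<in> ?J"
        using step.hyps by (intro relation_span_const_mult relation_span_generator) auto
      from step.IH show ?thesis
      proof (elim disjE exE conjE)
        fix u' j' i' v' c'
        assume *: "(j', i') \<in> M" "u' @ [j', i'] @ v' = W" "W \<in> words n"
          "f - const c' * (mon u' * relator h j' i' * mon v') \<in> ?J"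
        have "f + const c * ?g - const c' * (mon u' * relator h j' i' * mon v') \<in> ?J"
          using relation_span_add[OF *(4) g] by (simp add: algebra_simps)
        then show ?thesis using * by blast
      qed (use g relation_span_add in blast)
    next
      case True
      have W: "W \<in> words n"
        using True step.hyps(3) by blast
      from step.IH show ?thesis
      proof (elim disjE exE conjE)
        assume "f \<in> ?J"
        then have "f + const c * ?g - const c * ?g \<in> ?J"
          by simp
        then show ?thesis using True step.hyps(2) W by blast
      next
        fix u' j' i' v' c'
        let ?g' = "mon u' * relator h j' i' * mon v'"
        assume *: "(j', i') \<in> M" "u' @ [j', i'] @ v' = W" "f - const c' * ?g' \<in> ?J"
        have "?g' - ?g \<in> ?J"
          using relator_multiples_congruent[OF overlaps *(1) step.hyps(2) *(2) True W] .
        then have "f - const c' * ?g' + const c' * (?g' - ?g) \<in> ?J"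
          using *(3) by (intro relation_span_add relation_span_const_mult)
        \<comment> \<open>The earlier top multiple \<open>?g'\<close> is exchanged for
          \<open>?g\<close>, with total coefficient \<open>c + c'\<close>; the error
          \<open>?g' - ?g\<close> lies strictly below \<open>W\<close>.\<close>
        moreover have "f + const c * ?g - const (c + c') * ?g =
            f - const c' * ?g' + const c' * (?g' - ?g)"
          by (simp add: single_add algebra_simps)
        ultimately have "f + const c * ?g - const (c + c') * ?g \<in> ?J"
          by (simp only:)
        then show ?thesis using True step.hyps(2) W by blast
      qed
    qed
  qed
  then show ?case
  proof (elim disjE exE conjE)
    fix u j i v c
    let ?g = "mon u * relator h j i * mon v"
    assume ji: "(j, i) \<in> M" and W: "u @ [j, i] @ v = W" "W \<in> words n"
      and diff: "f - const c * ?g \<in> ?J"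
    \<comment> \<open>For \<open>c = 0\<close> the top terms have cancelled. For
      \<open>c \<noteq> 0\<close> the remainder has only words below \<open>W\<close> and cannot
      cancel the coefficient of \<open>W\<close>.\<close>
    show ?thesis
    proof (cases "c = 0")
      case True
      then show ?thesis using diff below by simp
    next
      case False
      have "w < W" if "w \<in> Poly_Mapping.keys (f - const c * ?g)" for w
        using span_keys[OF diff _ that] by auto
      then have "W \<notin> Poly_Mapping.keys (f - const c * ?g)"
        by blast
      then have "Poly_Mapping.lookup f W = c"
        using lookup_relator_multiple[OF ji, of u v] W
        by (simp add: in_keys_iff lookup_minus lookup_const_mult)
      then have "W \<in> Poly_Mapping.keys f"
        using False by (simp add: in_keys_iff)
      moreover have "w \<le> W" if "w \<in> Poly_Mapping.keys f" for w
        using span_keys[OF less.prems(1) _ that] by auto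
      ultimately have "LM f = W"
        by (rule LM_eqI)
      then show ?thesis using ji W(1) unfolding reducible_iff by metis
    qed
  qed (rule below)
qed

text \<open>The two copies of \<open>[k, j, i]\<close> cancel, which leaves
  \<open>x_k h_ji - h_kj x_i\<close>.\<close>

lemma overlap_composition_keys:
  assumes "(k, j) \<in> M" and "(j, i) \<in> M"
  shows "Poly_Mapping.keys (overlap_composition h k j i) \<subseteq>
    {w \<in> words n. length w = 3 \<and> w < [k, j, i]}"
proof -
  have "overlap_composition h k j i = mon [k] * h j i * mon [] - mon [] * h k j * mon [i]"
    by (simp add: overlap_composition_def relator_def right_diff_distrib left_diff_distrib
        mon_mult const_one)
  moreover have "Poly_Mapping.keys (mon [k] * h j i * mon []) \<subseteq>
      {w \<in> words n. length w = 3 \<and> w < [k, j, i]}"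
    using keys_sandwich[of "[k]" "h j i" "[]"] h_keys[OF assms(2)] M_le[OF assms(1)]
      append_less_appendI[of _ "[j, i]" "[k]"] by fastforce
  moreover have "Poly_Mapping.keys (mon [] * h k j * mon [i]) \<subseteq>
      {w \<in> words n. length w = 3 \<and> w < [k, j, i]}"
    using keys_sandwich[of "[]" "h k j" "[i]"] h_keys[OF assms(1)] M_le[OF assms(2)]
      append_less_append_rightI[of _ "[k, j]" "[i]"] by fastforce
  ultimately show ?thesis
    using keys_minus_subset[of "mon [k] * h j i * mon []" "mon [] * h k j * mon [i]"] by auto
qed

text \<open>The steps of a reduction of the composition to \<open>0\<close> add up to a
  representation of it with leading words below the ambiguity.\<close>

lemma LM_reducible_of_solvable:
  assumes "\<And>k j i. (k, j) \<in> M \<Longrightarrow> (j, i) \<in> M \<Longrightarrow> solvable_ambiguity n M h k j i"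
    and "f \<in> span_of (words n)" and "f \<noteq> 0"
  shows "reducible (LM f)"
proof -
  have "overlap_composition h k j i \<in> span_of {w \<in> words n. w < [k, j, i]}"
    if "(k, j) \<in> M" "(j, i) \<in> M" for k j i
    using reduces_rtranclp_span[of "overlap_composition h k j i" 0 "{w \<in> words n. w < [k, j, i]}"]
      overlap_composition_keys[OF that] assms(1)[OF that]
    by (fastforce simp: solvable_ambiguity_def)
  moreover obtain W where "f \<in> span_of {w \<in> words n. w \<le> W}"
    using relation_span_bounded[OF assms(2)] assms(3) by blast
  ultimately show ?thesis
    using LM_reducible_of_bounded assms(3) by blast
qed


subsection \<open>Normal forms\<close>

text \<open>A reduction acts only on a word containing some \<open>[j, i]\<close> with
  \<open>(j, i) \<in> M\<close>, so a normal term can be carried along unchanged.\<close>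

lemma reduces_add_normal:
  assumes "reduces n M h f g" and "\<not> reducible w"
  shows "reduces n M h (f + const c * mon w) (g + const c * mon w)"
proof -
  obtain u v j i where r: "u \<in> words n" "v \<in> words n" "(j, i) \<in> M" "g = reduction h u j i v f"
    using assms(1) by (auto simp: reduces_def)
  then have "w \<noteq> u @ [j, i] @ v"
    using assms(2) by (auto simp: reducible_iff)
  then have "g + const c * mon w = reduction h u j i v (f + const c * mon w)"
    by (simp add: r(4) reduction_eq lookup_add lookup_const_mult lookup_single when_def)
  then show ?thesis
    using r(1-3) unfolding reduces_def
    by (intro bexI[of _ u] bexI[of _ v] bexI[of _ "(j, i)"]) auto
qed

lemma reduces_rtranclp_add_normal:
  "(reduces n M h)\<^sup>*\<^sup>* f g \<Longrightarrow> \<not> reducible w \<Longrightarrow>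
    (reduces n M h)\<^sup>*\<^sup>* (f + const c * mon w) (g + const c * mon w)"
  by (induction rule: rtranclp_induct) (auto intro: rtranclp.rtrancl_into_rtrancl reduces_add_normal)

text \<open>Well-founded induction on the bound: a reducible top word is removed by one reduction, a
  normal one is set aside, and what remains has a smaller leading monomial or is zero.\<close>

lemma normal_form_below:
  assumes "Poly_Mapping.keys f \<subseteq> {w \<in> words n. w \<le> W}"
  shows "\<exists>g. (reduces n M h)\<^sup>*\<^sup>* f g \<and> Poly_Mapping.keys g \<subseteq> {w \<in> words n. \<not> reducible w}"
  using assms
proof (induction W arbitrary: f rule: less_induct)
  case (less W)
  have below: "\<exists>g. (reduces n M h)\<^sup>*\<^sup>* f g \<and> Poly_Mapping.keys g \<subseteq> {w \<in> words n. \<not> reducible w}"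
    if f: "Poly_Mapping.keys f \<subseteq> {w \<in> words n. w \<le> W}" "W \<notin> Poly_Mapping.keys f" for f
  proof (cases "f = 0")
    case True
    then show ?thesis by (intro exI[of _ 0]) simp
  next
    case False
    then have "LM f < W"
      using f LM_in_keys[of f] by (metis (no_types, lifting) mem_Collect_eq order_le_less subsetD)
    moreover have "Poly_Mapping.keys f \<subseteq> {w \<in> words n. w \<le> LM f}"
      using f LM_greatest by blast
    ultimately show ?thesis
      by (rule less.IH)
  qed
  show ?case
  proof (cases "W \<in> Poly_Mapping.keys f")
    case False
    then show ?thesis using below less.prems by blast
  next
    case True
    then have W: "W \<in> words n"
      using less.prems by blast
    let ?c = "Poly_Mapping.lookup f W"
    show ?thesis
    proof (cases "reducible W")
      case True
      then obtain u j i v where ji: "(j, i) \<in> M" and Wuv: "W = u @ [j, i] @ v"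
        by (auto simp: reducible_iff)
      let ?g = "mon u * relator h j i * mon v" and ?f' = "reduction h u j i v f"
      have f': "?f' = f - const ?c * ?g"
        by (simp only: reduction_eq Wuv)
      have "Poly_Mapping.keys (const ?c * ?g) \<subseteq> {w \<in> words n. w \<le> W}"
        using keys_const_mult[of ?c ?g] relator_multiple_keys[OF ji, of u v] W Wuv by blast
      then have "Poly_Mapping.keys ?f' \<subseteq> {w \<in> words n. w \<le> W}"
        using less.prems keys_minus_subset[of f "const ?c * ?g"] unfolding f' by blast
      moreover have "W \<notin> Poly_Mapping.keys ?f'"
        using lookup_relator_multiple[OF ji, of u v] unfolding f' Wuv
        by (simp add: in_keys_iff lookup_minus lookup_const_mult)
      ultimately obtain g where "(reduces n M h)\<^sup>*\<^sup>* ?f' g"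
        "Poly_Mapping.keys g \<subseteq> {w \<in> words n. \<not> reducible w}"
        using below by blast
      moreover have "reduces n M h f ?f'"
        using ji W Wuv by (auto simp: reduces_def)
      ultimately show ?thesis
        by (meson converse_rtranclp_into_rtranclp)
    next
      case False
      \<comment> \<open>The normal top term is removed, the rest is reduced, and the term is added
        back.\<close>
      let ?f' = "f - const ?c * mon W"
      have "Poly_Mapping.keys ?f' \<subseteq> Poly_Mapping.keys f - {W}"
        by (auto simp: in_keys_iff lookup_minus lookup_const_mult lookup_single when_def
            split: if_splits)
      then obtain g where g: "(reduces n M h)\<^sup>*\<^sup>* ?f' g"
        "Poly_Mapping.keys g \<subseteq> {w \<in> words n. \<not> reducible w}"
        using below[of ?f'] less.prems by blast
      have "(reduces n M h)\<^sup>*\<^sup>* f (g + const ?c * mon W)"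
        using reduces_rtranclp_add_normal[OF g(1) False, of ?c] by simp
      moreover have "Poly_Mapping.keys (g + const ?c * mon W) \<subseteq> {w \<in> words n. \<not> reducible w}"
        using keys_add[of g "const ?c * mon W"] keys_const_mult[of ?c "mon W"] g(2) W False by auto
      ultimately show ?thesis by blast
    qed
  qed
qed

lemma normal_form:
  assumes "Poly_Mapping.keys f \<subseteq> words n" and "homogeneous d f"
  obtains g where "(reduces n M h)\<^sup>*\<^sup>* f g" and "f - g \<in> span_of (words n)"
    and "Poly_Mapping.keys g \<subseteq> {w \<in> normal_words n (relators M h). length w = d}"
proof -
  have "Poly_Mapping.keys f \<subseteq> {w \<in> words n. w \<le> LM f}"
    using assms(1) LM_greatest by blast
  then obtain g where g: "(reduces n M h)\<^sup>*\<^sup>* f g"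
    "Poly_Mapping.keys g \<subseteq> {w \<in> words n. \<not> reducible w}"
    using normal_form_below by blast
  have "f - g \<in> span_of {w \<in> words n. length w = d} \<and>
      Poly_Mapping.keys g \<subseteq> {w \<in> words n. length w = d}"
    by (rule reduces_rtranclp_span[OF g(1)]) (use assms in \<open>auto simp: homogeneous_def\<close>)
  moreover from this have "f - g \<in> span_of (words n)"
    using relation_span_mono by blast
  ultimately show thesis
    using that[OF g(1)] g(2) by (auto simp: normal_words_relators)
qed

lemma overlap_composition_in_span:
  assumes "(k, j) \<in> M" and "(j, i) \<in> M"
  shows "overlap_composition h k j i \<in> span_of (words n)"
proof -
  have "overlap_composition h k j i =
      mon [] * relator h k j * mon [i] - mon [k] * relator h j i * mon []"
    by (simp only: overlap_composition_def const_one mult_1 mult_1_right)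
  moreover have "mon [] * relator h k j * mon [i] \<in> span_of (words n)"
    "mon [k] * relator h j i * mon [] \<in> span_of (words n)"
    using assms M_le by (auto intro!: relation_span_generator)
  ultimately show ?thesis
    using relation_span_diff by metis
qed

lemma solvable_of_independent:
  assumes "\<And>f. f \<in> span_of (words n) \<Longrightarrow>
      Poly_Mapping.keys f \<subseteq> {w \<in> normal_words n (relators M h). length w = 3} \<Longrightarrow> f = 0"
    and "(k, j) \<in> M" and "(j, i) \<in> M"
  shows "solvable_ambiguity n M h k j i"
proof -
  let ?f = "overlap_composition h k j i"
  have "Poly_Mapping.keys ?f \<subseteq> words n" "homogeneous 3 ?f"
    using overlap_composition_keys[OF assms(2,3)] by (auto simp: homogeneous_def)
  then obtain g where g: "(reduces n M h)\<^sup>*\<^sup>* ?f g" "?f - g \<in> span_of (words n)"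
    "Poly_Mapping.keys g \<subseteq> {w \<in> normal_words n (relators M h). length w = 3}"
    by (rule normal_form)
  have "?f - (?f - g) \<in> span_of (words n)"
    by (intro relation_span_diff overlap_composition_in_span assms(2,3) g(2))
  then have "g = 0"
    using assms(1) g(3) by simp
  then show ?thesis
    using g(1) by (simp add: solvable_ambiguity_def)
qed

end


subsection \<open>Dimensions in quotients of the free algebra\<close>

text \<open>The ground field as a record, so that results on images of fields under ring
  homomorphisms apply to \<open>quot_scalar\<close>.\<close>

lemma field_UNIV:
  "Ring.field \<lparr>carrier = UNIV :: 'k::field set, monoid.mult = (*), one = 1, ring.zero = 0, ring.add = (+)\<rparr>"
  (is "Ring.field ?K")
proof -
  have "cring ?K"
    by (rule cringI, rule abelian_groupI, auto simp: algebra_simps intro: exI[of _ "- _"]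
        intro!: comm_monoidI)
  then show ?thesis
  proof (rule cring.cring_fieldI2)
    fix a assume "a \<in> carrier ?K" "a \<noteq> \<zero>\<^bsub>?K\<^esub>"
    then show "\<exists>b\<in>carrier ?K. a \<otimes>\<^bsub>?K\<^esub> b = \<one>\<^bsub>?K\<^esub>"
      by (intro bexI[of _ "inverse a"]) auto
  qed simp
qed

locale free_algebra_ideal =
  fixes n :: nat and I :: "'k::field ncpoly set"
  assumes ideal: "ideal I (free_algebra n)"
begin

abbreviation F :: "'k ncpoly ring" where "F \<equiv> free_algebra n"
abbreviation Q :: "'k ncpoly set ring" where "Q \<equiv> quot_algebra n I"
abbreviation cls :: "'k ncpoly \<Rightarrow> 'k ncpoly set" where "cls f \<equiv> I +>\<^bsub>F\<^esub> f"
abbreviation scalars :: "'k ncpoly set set" where "scalars \<equiv> range (quot_scalar n I)"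

text \<open>The linear span of the classes of words in \<open>S\<close>, written as an image so that
  membership means having a representative supported on \<open>S\<close>.\<close>

definition class_span :: "word set \<Rightarrow> 'k ncpoly set set"
  where "class_span S = cls ` {f. Poly_Mapping.keys f \<subseteq> S}"

lemma ring_quot: "ring Q"
  unfolding quot_algebra_def by (intro ideal.quotient_is_ring ideal)

lemma cls_hom: "ring_hom_ring F Q cls"
  unfolding quot_algebra_def by (intro ideal.rcos_ring_hom_ring ideal)

lemma carrier_iff: "f \<in> carrier F \<longleftrightarrow> Poly_Mapping.keys f \<subseteq> words n"
  by (simp add: free_algebra_def)

lemma const_in_carrier: "const c \<in> carrier F"
  by (auto simp: carrier_iff)

lemma cls_add:
  assumes "f \<in> carrier F" and "g \<in> carrier F"
  shows "cls (f + g) = cls f \<oplus>\<^bsub>Q\<^esub> cls g"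
proof -
  interpret ring_hom_ring F Q cls by (rule cls_hom)
  show ?thesis using hom_add[OF assms] by (simp add: free_algebra_def)
qed

lemma cls_mult:
  assumes "f \<in> carrier F" and "g \<in> carrier F"
  shows "cls (f * g) = cls f \<otimes>\<^bsub>Q\<^esub> cls g"
proof -
  interpret ring_hom_ring F Q cls by (rule cls_hom)
  show ?thesis using hom_mult[OF assms] by (simp add: free_algebra_def)
qed

lemma cls_in_carrier: "f \<in> carrier F \<Longrightarrow> cls f \<in> carrier Q"
proof -
  interpret ring_hom_ring F Q cls by (rule cls_hom)
  show "f \<in> carrier F \<Longrightarrow> cls f \<in> carrier Q" by (rule hom_closed)
qed

lemma cls_zero: "cls 0 = \<zero>\<^bsub>Q\<^esub>"
proof -
  interpret ring_hom_ring F Q cls by (rule cls_hom)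
  show ?thesis using hom_zero by (simp add: free_algebra_def)
qed

lemma cls_one: "cls 1 = \<one>\<^bsub>Q\<^esub>"
proof -
  interpret ring_hom_ring F Q cls by (rule cls_hom)
  show ?thesis using hom_one by (simp add: free_algebra_def)
qed

lemma cls_eq_iff:
  assumes f: "f \<in> carrier F" and g: "g \<in> carrier F"
  shows "cls f = cls g \<longleftrightarrow> f - g \<in> I"
proof -
  interpret F: ring F by (rule ring_free_algebra)
  have "f \<ominus>\<^bsub>F\<^esub> g = f - g"
    unfolding a_minus_def uminus_free_algebra[OF g] by (simp add: free_algebra_def)
  then show ?thesis
    using F.quotient_eq_iff_same_a_r_cos[OF ideal f g] by simp
qed

text \<open>The image of a field in a nonzero ring is a field; \<open>1 \<notin> I\<close> makes the
  quotient nonzero. Uniqueness of dimension depends on this.\<close>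

lemma subfield_scalars:
  assumes "1 \<notin> I"
  shows "subfield scalars Q"
proof -
  let ?K = "\<lparr>carrier = UNIV :: 'k set, monoid.mult = (*), one = 1, ring.zero = 0, ring.add = (+)\<rparr>"
  interpret K: Ring.field ?K by (rule field_UNIV)
  have scalar: "quot_scalar n I c = cls (const c)" for c
    by (simp add: quot_scalar_def)
  have hom: "ring_hom_ring ?K Q (quot_scalar n I)"
  proof (rule ring_hom_ringI[OF K.ring_axioms ring_quot])
    fix a b :: 'k
    show "quot_scalar n I a \<in> carrier Q"
      by (simp add: scalar cls_in_carrier const_in_carrier)
    show "quot_scalar n I (a \<otimes>\<^bsub>?K\<^esub> b) = quot_scalar n I a \<otimes>\<^bsub>Q\<^esub> quot_scalar n I b"
      by (simp add: scalar const_in_carrier flip: cls_mult const_mult_const)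
    show "quot_scalar n I (a \<oplus>\<^bsub>?K\<^esub> b) = quot_scalar n I a \<oplus>\<^bsub>Q\<^esub> quot_scalar n I b"
      by (simp add: scalar const_in_carrier single_add flip: cls_add)
    show "quot_scalar n I \<one>\<^bsub>?K\<^esub> = \<one>\<^bsub>Q\<^esub>"
      by (simp add: scalar const_one cls_one)
  qed
  have "\<one>\<^bsub>Q\<^esub> \<noteq> \<zero>\<^bsub>Q\<^esub>"
    using assms cls_eq_iff[of 1 0] by (simp add: carrier_iff cls_one cls_zero zero_list_def)
  then show ?thesis
    using ring_hom_ring.img_is_subfield(2)[OF hom K.carrier_is_subfield] by simp
qed

text \<open>Adding a word to \<open>S\<close> is one step of the inductive definition of
  dimension.\<close>

lemma line_extension_class_span:
  assumes "insert w S \<subseteq> words n"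
  shows "ring.line_extension Q scalars (cls (mon w)) (class_span S) = class_span (insert w S)"
proof -
  interpret Q: ring Q by (rule ring_quot)
  have sub: "f \<in> carrier F" if "Poly_Mapping.keys f \<subseteq> insert w S" for f :: "'k ncpoly"
    using that assms by (auto simp: carrier_iff)
  have w: "mon w \<in> carrier F"
    by (intro sub) simp
  have line: "quot_scalar n I c \<otimes>\<^bsub>Q\<^esub> cls (mon w) \<oplus>\<^bsub>Q\<^esub> cls f = cls (const c * mon w + f)"
    if "Poly_Mapping.keys f \<subseteq> insert w S" for c f
  proof -
    have "const c * mon w \<in> carrier F"
      using keys_const_mult[of c "mon w"] by (intro sub) auto
    then show ?thesis
      using sub[OF that] w by (simp only: quot_scalar_def cls_add cls_mult const_in_carrier)
  qed
  show ?thesis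
  proof (intro equalityI subsetI)
    fix x assume "x \<in> Q.line_extension scalars (cls (mon w)) (class_span S)"
    then obtain c f where f: "Poly_Mapping.keys f \<subseteq> S"
      and x: "x = quot_scalar n I c \<otimes>\<^bsub>Q\<^esub> cls (mon w) \<oplus>\<^bsub>Q\<^esub> cls f"
      unfolding Q.line_extension_mem_iff class_span_def by blast
    have "x = cls (const c * mon w + f)"
      unfolding x using f by (intro line) blast
    moreover have "Poly_Mapping.keys (const c * mon w + f) \<subseteq> insert w S"
      using keys_add[of "const c * mon w" f] keys_const_mult[of c "mon w"] f by auto
    ultimately show "x \<in> class_span (insert w S)"
      unfolding class_span_def by blast
  next
    fix x assume "x \<in> class_span (insert w S)"
    then obtain f where f: "Poly_Mapping.keys f \<subseteq> insert w S" and x: "x = cls f"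
      unfolding class_span_def by blast
    let ?c = "Poly_Mapping.lookup f w"
    have keys: "Poly_Mapping.keys (f - const ?c * mon w) \<subseteq> Poly_Mapping.keys f - {w}"
      by (auto simp: in_keys_iff lookup_minus lookup_const_mult lookup_single when_def
            split: if_splits)
    have "x = quot_scalar n I ?c \<otimes>\<^bsub>Q\<^esub> cls (mon w) \<oplus>\<^bsub>Q\<^esub> cls (f - const ?c * mon w)"
      using keys f by (subst line) (auto simp: x)
    moreover have "cls (f - const ?c * mon w) \<in> class_span S"
      using keys f unfolding class_span_def by blast
    ultimately show "x \<in> Q.line_extension scalars (cls (mon w)) (class_span S)"
      unfolding Q.line_extension_mem_iff by blast
  qed
qed

lemma class_span_empty: "class_span {} = {\<zero>\<^bsub>Q\<^esub>}"
  by (auto simp: class_span_def cls_zero)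

text \<open>Subtracting a suitable multiple of the relation \<open>f\<close> eliminates
  \<open>w\<close> from any representative.\<close>

lemma class_span_insert_redundant:
  assumes f: "f \<in> I" "Poly_Mapping.keys f \<subseteq> insert w S" "w \<in> Poly_Mapping.keys f"
    and "insert w S \<subseteq> words n"
  shows "class_span (insert w S) = class_span S"
proof
  show "class_span S \<subseteq> class_span (insert w S)"
    unfolding class_span_def by blast
  show "class_span (insert w S) \<subseteq> class_span S"
  proof
    fix x assume "x \<in> class_span (insert w S)"
    then obtain g where g: "Poly_Mapping.keys g \<subseteq> insert w S" and x: "x = cls g"
      unfolding class_span_def by blast
    let ?d = "Poly_Mapping.lookup g w / Poly_Mapping.lookup f w"
    let ?g = "g - const ?d * f"
    have "w \<notin> Poly_Mapping.keys ?g"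
      using f(3) by (simp add: in_keys_iff lookup_minus lookup_const_mult)
    moreover have "Poly_Mapping.keys ?g \<subseteq> insert w S"
      using keys_minus_subset[of g "const ?d * f"] keys_const_mult[of ?d f] f(2) g by blast
    ultimately have keys: "Poly_Mapping.keys ?g \<subseteq> S"
      by blast
    have "const ?d \<otimes>\<^bsub>F\<^esub> f \<in> I"
      by (intro ideal.I_l_closed[OF ideal] f(1) const_in_carrier)
    then have "g - ?g \<in> I"
      by (simp add: free_algebra_def)
    then have "x = cls ?g"
      using cls_eq_iff[of g ?g] g keys assms(4) unfolding x carrier_iff by blast
    then show "x \<in> class_span S"
      using keys unfolding class_span_def by blast
  qed
qed

text \<open>Words are added one at a time; each either lies in the span already or raises the
  dimension by one.\<close>

lemma dimension_class_span_le:
  assumes "finite S" and "S \<subseteq> words n"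
  shows "\<exists>d\<le>card S. ring.dimension Q d scalars (class_span S)"
  using assms
proof (induction S rule: finite_induct)
  interpret Q: ring Q by (rule ring_quot)
  case empty
  show ?case using Q.zero_dim by (simp add: class_span_empty)
next
  interpret Q: ring Q by (rule ring_quot)
  case (insert w S)
  then obtain d where d: "d \<le> card S" "Q.dimension d scalars (class_span S)"
    by auto
  have w: "cls (mon w) \<in> carrier Q"
    using insert.prems by (intro cls_in_carrier) (simp add: carrier_iff)
  show ?case
  proof (cases "cls (mon w) \<in> class_span S")
    case True
    then obtain f where f: "Poly_Mapping.keys f \<subseteq> S" "cls (mon w) = cls f"
      unfolding class_span_def by blast
    then have "mon w - f \<in> I"
      using cls_eq_iff[of "mon w" f] insert.prems by (auto simp: carrier_iff)
    moreover have "Poly_Mapping.keys (mon w - f) \<subseteq> insert w S"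
      using keys_minus_subset[of "mon w" f] f(1) by auto
    moreover have "w \<notin> Poly_Mapping.keys f"
      using f(1) insert.hyps(2) by blast
    then have "w \<in> Poly_Mapping.keys (mon w - f)"
      by (simp add: in_keys_iff lookup_minus)
    ultimately have "class_span (insert w S) = class_span S"
      using insert.prems by (rule class_span_insert_redundant)
    then show ?thesis using d insert.hyps by (auto intro!: exI[of _ d])
  next
    case False
    then have "Q.dimension (Suc d) scalars (class_span (insert w S))"
      using Q.Suc_dim[OF w False d(2)] line_extension_class_span[OF insert.prems] by simp
    then show ?thesis using d insert.hyps by (auto intro!: exI[of _ "Suc d"])
  qed
qed

lemma dimension_class_span_card:
  assumes "finite S" and "S \<subseteq> words n"
    and "\<And>f. f \<in> I \<Longrightarrow> Poly_Mapping.keys f \<subseteq> S \<Longrightarrow> f = 0"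
  shows "ring.dimension Q (card S) scalars (class_span S)"
  using assms
proof (induction S rule: finite_induct)
  interpret Q: ring Q by (rule ring_quot)
  case empty
  show ?case using Q.zero_dim by (simp add: class_span_empty)
next
  interpret Q: ring Q by (rule ring_quot)
  case (insert w S)
  have w: "cls (mon w) \<in> carrier Q"
    using insert.prems by (intro cls_in_carrier) (simp add: carrier_iff)
  have "cls (mon w) \<notin> class_span S"
  proof
    assume "cls (mon w) \<in> class_span S"
    then obtain f where f: "Poly_Mapping.keys f \<subseteq> S" "cls (mon w) = cls f"
      unfolding class_span_def by blast
    then have "mon w - f \<in> I"
      using cls_eq_iff[of "mon w" f] insert.prems by (auto simp: carrier_iff)
    moreover have "Poly_Mapping.keys (mon w - f) \<subseteq> insert w S"
      using keys_minus_subset[of "mon w" f] f(1) by auto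
    ultimately have "mon w - f = 0"
      by (rule insert.prems(2))
    moreover have "w \<notin> Poly_Mapping.keys f"
      using f(1) insert.hyps(2) by blast
    ultimately show False
      by auto
  qed
  moreover have "Q.dimension (card S) scalars (class_span S)"
    using insert.prems by (intro insert.IH) auto
  ultimately show ?case
    using Q.Suc_dim[OF w, of "class_span S" "card S" scalars] insert.hyps
      line_extension_class_span[OF insert.prems(1)] by simp
qed

text \<open>A nonzero relation supported on \<open>S\<close> makes one of its words redundant, so
  the dimension is at most \<open>card S - 1\<close>, and dimension is unique. Without relations,
  each added word is a proper extension.\<close>

lemma dimension_class_span_iff:
  assumes "1 \<notin> I" and S: "finite S" "S \<subseteq> words n"
  shows "ring.dimension Q (card S) scalars (class_span S) \<longleftrightarrow>
    (\<forall>f\<in>I. Poly_Mapping.keys f \<subseteq> S \<longrightarrow> f = 0)"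
proof (intro iffI ballI impI)
  interpret Q: ring Q by (rule ring_quot)
  fix f assume dim: "Q.dimension (card S) scalars (class_span S)"
    and f: "f \<in> I" "Poly_Mapping.keys f \<subseteq> S"
  show "f = 0"
  proof (rule ccontr)
    assume "f \<noteq> 0"
    then obtain w where w: "w \<in> Poly_Mapping.keys f"
      using LM_in_keys by blast
    then have insert: "insert w (S - {w}) = S"
      using f(2) by blast
    have "class_span S = class_span (S - {w})"
      using class_span_insert_redundant[of f w "S - {w}"] f w S(2) unfolding insert by blast
    moreover obtain d where d: "d \<le> card (S - {w})"
      "Q.dimension d scalars (class_span (S - {w}))"
      using dimension_class_span_le[of "S - {w}"] S by blast
    ultimately have "d = card S"
      using Q.dimension_is_inj[OF subfield_scalars[OF assms(1)]] dim by metis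
    then show False
      using d(1) w f(2) S(1) card_Diff1_less[of S w] by auto
  qed
next
  assume "\<forall>f\<in>I. Poly_Mapping.keys f \<subseteq> S \<longrightarrow> f = 0"
  then show "ring.dimension Q (card S) scalars (class_span S)"
    using S by (intro dimension_class_span_card) auto
qed

end

subsection \<open>The equivalence\<close>

context quadratic_relations
begin

text \<open>Leading words contain two letters and relators preserve length, so the empty word never
  occurs in an element of the ideal.\<close>

lemma one_notin_span: "1 \<notin> span_of (words n)"
proof
  assume one: "(1 :: 'k ncpoly) \<in> span_of (words n)"
  have "length w \<ge> 2" if "w \<in> Poly_Mapping.keys f" "f \<in> span_of (words n)" for f w
  proof -
    have "f \<in> span_of {w \<in> words n. length w \<ge> 2}"
      using that(2)
    proof (induction rule: relation_span.induct)
      case (step f j i u v c)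
      then show ?case by (intro relation_span.step) auto
    qed (rule relation_span.zero)
    then show ?thesis
      using span_keys[of f "{w \<in> words n. length w \<ge> 2}" w] that(1) by force
  qed
  from this[OF _ one, of "[]"] show False
    by (simp add: zero_list_def)
qed

sublocale relator_ideal: free_algebra_ideal n "span_of (words n)"
  by (rule free_algebra_ideal.intro) (rule ideal_span_of)

abbreviation normal_cubes :: "word set"
  where "normal_cubes \<equiv> {w \<in> normal_words n (relators M h). length w = 3}"

text \<open>A homogeneous polynomial is congruent to its normal form, which has the same degree;
  hence normal words span every component.\<close>

lemma quot_component_eq_class_span:
  "quot_component n (span_of (words n)) d =
    relator_ideal.class_span {w \<in> normal_words n (relators M h). length w = d}"
proof (intro equalityI subsetI)
  fix x assume "x \<in> quot_component n (span_of (words n)) d"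
  then obtain f where f: "Poly_Mapping.keys f \<subseteq> words n" "homogeneous d f"
    and x: "x = relator_ideal.cls f"
    unfolding quot_component_def relator_ideal.carrier_iff by blast
  then obtain g where g: "f - g \<in> span_of (words n)"
    "Poly_Mapping.keys g \<subseteq> {w \<in> normal_words n (relators M h). length w = d}"
    using normal_form by blast
  then have "Poly_Mapping.keys g \<subseteq> words n"
    by (auto simp: normal_words_def)
  then have "x = relator_ideal.cls g"
    using relator_ideal.cls_eq_iff[of f g] f(1) g(1) x by (simp add: relator_ideal.carrier_iff)
  then show "x \<in> relator_ideal.class_span {w \<in> normal_words n (relators M h). length w = d}"
    using g(2) unfolding relator_ideal.class_span_def by blast
next
  fix x assume "x \<in> relator_ideal.class_span {w \<in> normal_words n (relators M h). length w = d}"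
  then obtain f where f: "Poly_Mapping.keys f \<subseteq> {w \<in> normal_words n (relators M h). length w = d}"
    and x: "x = relator_ideal.cls f"
    unfolding relator_ideal.class_span_def by blast
  then have "f \<in> carrier (free_algebra n)" "homogeneous d f"
    by (auto simp: relator_ideal.carrier_iff homogeneous_def normal_words_def)
  then show "x \<in> quot_component n (span_of (words n)) d"
    unfolding quot_component_def x by blast
qed

lemma component_dim_3_iff:
  "component_dim n (span_of (words n)) 3 (card normal_cubes) \<longleftrightarrow>
    (\<forall>f\<in>span_of (words n). Poly_Mapping.keys f \<subseteq> normal_cubes \<longrightarrow> f = 0)"
  unfolding component_dim_def quot_component_eq_class_span
proof (rule relator_ideal.dimension_class_span_iff[OF one_notin_span])
  show "finite normal_cubes"
    by (rule finite_subset[OF _ finite_words_of_length[of n 3]]) (auto simp: normal_words_def)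
  show "normal_cubes \<subseteq> words n"
    by (auto simp: normal_words_def)
qed

text \<open>Proved as a cycle: Groebner basis, dimension, solvability, Groebner basis.\<close>

theorem groebner_basis_tfae:
  defines "I \<equiv> Idl\<^bsub>free_algebra n\<^esub> (relators M h)"
  shows "groebner_basis n (relators M h) I \<longleftrightarrow> component_dim n I 3 (card normal_cubes)"
    and "component_dim n I 3 (card normal_cubes) \<longleftrightarrow>
      (\<forall>k j i. (k, j) \<in> M \<and> (j, i) \<in> M \<longrightarrow> solvable_ambiguity n M h k j i)"
proof -
  have dim: "component_dim n I 3 (card normal_cubes)" if "groebner_basis n (relators M h) I"
  proof -
    \<comment> \<open>A nonzero element of the ideal supported on normal words would have a leading
      monomial both normal and reducible.\<close>
    have "f = 0" if f: "f \<in> span_of (words n)" "Poly_Mapping.keys f \<subseteq> normal_cubes" for f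
    proof (rule ccontr)
      assume "f \<noteq> 0"
      then have "reducible (LM f)" "LM f \<in> normal_cubes"
        using \<open>groebner_basis n (relators M h) I\<close> f LM_in_keys[of f]
        unfolding I_def groebner_basis_relators_iff by blast+
      then show False
        by (simp add: normal_words_relators)
    qed
    then show ?thesis
      unfolding I_def genideal_relators component_dim_3_iff by blast
  qed
  have solvable: "solvable_ambiguity n M h k j i"
    if "component_dim n I 3 (card normal_cubes)" "(k, j) \<in> M" "(j, i) \<in> M" for k j i
    using that(1) solvable_of_independent[OF _ that(2,3)]
    unfolding I_def genideal_relators component_dim_3_iff by blast
  have groebner: "groebner_basis n (relators M h) I"
    if "\<forall>k j i. (k, j) \<in> M \<and> (j, i) \<in> M \<longrightarrow> solvable_ambiguity n M h k j i"
    unfolding I_def groebner_basis_relators_iff using that LM_reducible_of_solvable by blast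
  show "groebner_basis n (relators M h) I \<longleftrightarrow> component_dim n I 3 (card normal_cubes)"
    using dim solvable groebner by blast
  show "component_dim n I 3 (card normal_cubes) \<longleftrightarrow>
      (\<forall>k j i. (k, j) \<in> M \<and> (j, i) \<in> M \<longrightarrow> solvable_ambiguity n M h k j i)"
    using dim solvable groebner by blast
qed

text \<open>The given presentation is the witness, with the identity as isomorphism.\<close>

lemma pbw_algebra_quot:
  defines "I \<equiv> Idl\<^bsub>free_algebra n\<^esub> (relators M h)"
  assumes "groebner_basis n (relators M h) I"
  shows "pbw_algebra (quot_algebra n I) (quot_scalar n I) (quot_component n I)"
proof -
  have "homogeneous 2 f" if "f \<in> relators M h" for f
    using that relator_keys unfolding relators_def homogeneous_def by blast
  moreover have "id \<in> ring_iso (quot_algebra n I) (quot_algebra n I)"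
    by (auto simp: ring_iso_def ring_hom_def bij_betw_def)
  ultimately show ?thesis
    unfolding pbw_algebra_def using assms(2) relators_subset_carrier unfolding I_def
    by (intro exI[of _ n] exI[of _ "relators M h"] exI[of _ id]) simp
qed

end


theorem lemma2p7:
  fixes n :: nat
    and M :: "(nat \<times> nat) set"
    and h :: "nat \<Rightarrow> nat \<Rightarrow> 'k::field ncpoly"
    and R I :: "'k ncpoly set"
  assumes "M \<noteq> {}" and "M \<subset> {0..n} \<times> {0..n}"
    and "\<And>j i. (j, i) \<in> M \<Longrightarrow> h j i \<in> carrier (free_algebra n)"
    and "\<And>j i. (j, i) \<in> M \<Longrightarrow> h j i = 0 \<or> (homogeneous 2 (h j i) \<and> LM (h j i) < [j, i])"
    and "R = relators M h"
    and "I = Idl\<^bsub>free_algebra n\<^esub> R"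
  shows "(groebner_basis n R I \<longleftrightarrow> component_dim n I 3 (card {w \<in> normal_words n R. length w = 3}))
    \<and> (component_dim n I 3 (card {w \<in> normal_words n R. length w = 3}) \<longleftrightarrow>
        (\<forall>k j i. (k, j) \<in> M \<and> (j, i) \<in> M \<longrightarrow> solvable_ambiguity n M h k j i))
    \<and> (groebner_basis n R I \<longrightarrow>
        pbw_algebra (quot_algebra n I) (quot_scalar n I) (quot_component n I))"
proof -
  interpret quadratic_relations n M h
  proof
    show "j \<le> n \<and> i \<le> n" if "(j, i) \<in> M" for j i
      using assms(2) that by auto
    show "w \<in> words n \<and> length w = 2 \<and> w < [j, i]"
      if "(j, i) \<in> M" "w \<in> Poly_Mapping.keys (h j i)" for j i w
    proof -
      \<comment> \<open>Having a word rules out \<open>h j i = 0\<close>, where \<open>LM\<close> is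
        meaningless; the bound on \<open>LM (h j i)\<close> then passes to all words.\<close>
      have "h j i \<noteq> 0"
        using that(2) by auto
      then have "homogeneous 2 (h j i)" "LM (h j i) < [j, i]"
        using assms(4)[OF that(1)] by auto
      then show ?thesis
        using assms(3)[OF that(1)] that(2) LM_greatest[OF that(2)]
        by (auto simp: free_algebra_def homogeneous_def)
    qed
  qed
  show ?thesis
    using groebner_basis_tfae pbw_algebra_quot unfolding assms(5,6) by blast
qed

end
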